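(* Let $N$ be the number of users, $N_c$ the number of tones and $L\ge N$ the number of modems. For $1\le i\le N_c$ and $1\le j\le N$ let $\mathbf{h}_{ij}\in\mathbb{C}^{1\times L}$ be the channel row vector of user $j$ on tone $i$, let $w_1>w_2>\cdots>w_N$ be the weights assigned to the users, and let $P_1^{tot},\dots,P_L^{tot}$ be the total power budgets of the modems. Then for a given diagonal matrix of Lagrange multipliers $\mathbf{\Lambda}=\mathrm{diag}(\lambda_1,\dots,\lambda_L)$ with $\lambda_l\ge 0$ for all $l$, $$F^{BC}(\mathbf{\Lambda})=F^{MAC}(\mathbf{\Lambda}),$$ where $F^{BC}$ is the dual objective function of the broadcast channel weighted-rate-sum problem under per-modem total power constraints, and $F^{MAC}$ is the dual objective function of the multiple access channel whose channel vectors are rescaled by the precoder matrix $\mathbf{\Lambda}^{-1/2}$; both functions are defined in the context.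
   Context: $(\cdot)^H$ is the conjugate transpose, $\mathbf{I}$ is the $L\times L$ identity matrix, and $\mathbf{\Lambda}^{-1/2}$ is the inverse square root of $\mathbf{\Lambda}$. The noise is white with identity covariance in both channels. Broadcast channel (BC) side: the variables are transmit covariance matrices $\mathbf{Q}_{ij}\in\mathbb{C}^{L\times L}$, $\mathbf{Q}_{ij}\succeq 0$ ($1\le i\le N_c$, $1\le j\le N$), and $$F^{BC}(\mathbf{\Lambda})=\max_{\mathbf{Q}_{ij}\succeq 0}\left\{\sum_{i=1}^{N_c}\left(\sum_{j=1}^{N} w_j\log_2\!\left[1+\mathbf{h}_{ij}\mathbf{Q}_{ij}\mathbf{h}_{ij}^H a_{ij}^{-1}\right]-\sum_{j=1}^{N}\mathrm{Trace}(\mathbf{\Lambda}\mathbf{Q}_{ij})\right)+\mathrm{Trace}\big(\mathbf{\Lambda}\,\mathrm{diag}(P_1^{tot},\dots,P_L^{tot})\big)\right\},$$ where $a_{ij}=1+\mathbf{h}_{ij}\big(\sum_{k=j+1}^{N}\mathbf{Q}_{ik}\big)\mathbf{h}_{ij}^H$ (user 1 is encoded first). The associated per-modem constraints are $\sum_{j=1}^{N}\sum_{i=1}^{N_c}(\mathbf{Q}_{ij})_{ll}\le P_l^{tot}$ for all $l$, where $(\mathbf{Q}_{ij})_{ll}$ is the $l$-th diagonal element. Multiple access channel (MAC) side: put $\mathbf{h}'_{ij}=\mathbf{h}_{ij}\mathbf{\Lambda}^{-1/2}$ and $\mathrm{diag}(P'^{tot}_1,\dots,P'^{tot}_L)=\mathbf{\Lambda}^{1/2}\mathrm{diag}(P_1^{tot},\dots,P_L^{tot})\mathbf{\Lambda}^{1/2}$.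 The variables are diagonal matrices $\mathbf{\Phi}'_i=\mathrm{diag}(\phi'_{i1},\dots,\phi'_{iN})\succeq 0$, $1\le i\le N_c$, and $$F^{MAC}(\mathbf{\Lambda})=\max_{\mathbf{\Phi}'_i\succeq 0}\left\{\sum_{i=1}^{N_c}\left(\sum_{j=1}^{N} w_j\log_2\!\left[\det\!\left(\mathbf{I}+\mathbf{h}'^{H}_{ij}\phi'_{ij}\mathbf{h}'_{ij}\mathbf{B}'^{-1}_{ij}\right)\right]-\mathrm{Trace}(\mathbf{\Phi}'_i)\right)+\mathrm{Trace}\big(\mathrm{diag}(P'^{tot}_1,\dots,P'^{tot}_L)\big)\right\},$$ where $\mathbf{B}'_{ij}=\mathbf{I}+\sum_{k=1}^{j-1}\mathbf{h}'^{H}_{ik}\phi'_{ik}\mathbf{h}'_{ik}$ (user 1 is decoded last).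
   Formalization: If some λ_l = 0, Λ^{-1/2} does not exist; there F^MAC(Λ) is taken as the limit of F^MAC(Λ+εI) as ε→0+. Each "max" is read as a supremum in the extended reals, since it may be infinite or not attained. *)

theory Defs
  imports "HOL-Analysis.Analysis"
begin

text \<open>
  The modems are indexed by a finite type 'l, so L = CARD('l); tones and users are indexed by
  natural numbers 1..Nc and 1..N. A matrix of type complex ^ 'n ^ 'm has 'm rows and 'n
  columns, so a channel row vector is a matrix of type complex ^ 'l ^ 1. Hermitian forms and
  their traces and determinants are complex numbers with vanishing imaginary part on the
  feasible sets below; Re converts them to reals.
\<close>

definition conj_transpose :: "complex ^ 'n ^ 'm \<Rightarrow> complex ^ 'm ^ 'n" where
  "conj_transpose A = (\<chi> i j. cnj (A $ j $ i))"

definition psd :: "complex ^ 'n ^ 'n \<Rightarrow> bool" where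
  "psd A \<longleftrightarrow> conj_transpose A = A \<and>
     (\<forall>x :: complex ^ 'n. 0 \<le> Re (\<Sum>k\<in>UNIV. cnj (x $ k) * (A *v x) $ k))"

definition diag_mat :: "real ^ 'n \<Rightarrow> complex ^ 'n ^ 'n" where
  "diag_mat v = (\<chi> i j. if i = j then complex_of_real (v $ i) else 0)"

definition diag_sqrt :: "real ^ 'n \<Rightarrow> complex ^ 'n ^ 'n" where
  "diag_sqrt v = diag_mat (\<chi> l. sqrt (v $ l))"

definition diag_inv_sqrt :: "real ^ 'n \<Rightarrow> complex ^ 'n ^ 'n" where
  "diag_inv_sqrt v = matrix_inv (diag_sqrt v)"

subsection \<open>Broadcast channel\<close>

definition bc_noise ::
  "nat \<Rightarrow> (nat \<Rightarrow> nat \<Rightarrow> complex ^ 'l ^ 1) \<Rightarrow> (nat \<Rightarrow> nat \<Rightarrow> complex ^ 'l ^ 'l) \<Rightarrow> nat \<Rightarrow> nat \<Rightarrow> complex"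
  where
  "bc_noise N h Q i j =
     1 + (h i j ** (\<Sum>k = j + 1..N. Q i k) ** conj_transpose (h i j)) $ 1 $ 1"

definition bc_objective ::
  "nat \<Rightarrow> nat \<Rightarrow> (nat \<Rightarrow> nat \<Rightarrow> complex ^ 'l ^ 1) \<Rightarrow> (nat \<Rightarrow> real) \<Rightarrow> real ^ 'l \<Rightarrow> real ^ 'l
   \<Rightarrow> (nat \<Rightarrow> nat \<Rightarrow> complex ^ 'l ^ 'l) \<Rightarrow> real"
  where
  "bc_objective Nc N h w P lam Q =
     (\<Sum>i = 1..Nc.
        (\<Sum>j = 1..N. w j * log 2 (Re (1 +
           (h i j ** Q i j ** conj_transpose (h i j)) $ 1 $ 1 * inverse (bc_noise N h Q i j))))
        - (\<Sum>j = 1..N. Re (trace (diag_mat lam ** Q i j))))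
     + Re (trace (diag_mat lam ** diag_mat P))"

text \<open>
  The maximum is taken in the extended reals: when some multiplier vanishes the objective may
  be unbounded, and the dual function then has the value infinity.
\<close>

definition F_BC ::
  "nat \<Rightarrow> nat \<Rightarrow> (nat \<Rightarrow> nat \<Rightarrow> complex ^ 'l ^ 1) \<Rightarrow> (nat \<Rightarrow> real) \<Rightarrow> real ^ 'l \<Rightarrow> real ^ 'l \<Rightarrow> ereal"
  where
  "F_BC Nc N h w P lam =
     (SUP Q \<in> {Q. \<forall>i\<in>{1..Nc}. \<forall>j\<in>{1..N}. psd (Q i j)}. ereal (bc_objective Nc N h w P lam Q))"

subsection \<open>Multiple access channel\<close>

definition scaled_channel ::
  "(nat \<Rightarrow> nat \<Rightarrow> complex ^ 'l ^ 1) \<Rightarrow> real ^ 'l \<Rightarrow> nat \<Rightarrow> nat \<Rightarrow> complex ^ 'l ^ 1" where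
  "scaled_channel h lam i j = h i j ** diag_inv_sqrt lam"

definition mac_gain ::
  "(nat \<Rightarrow> nat \<Rightarrow> complex ^ 'l ^ 1) \<Rightarrow> (nat \<Rightarrow> nat \<Rightarrow> real) \<Rightarrow> nat \<Rightarrow> nat \<Rightarrow> complex ^ 'l ^ 'l" where
  "mac_gain h' phi i j = phi i j *\<^sub>R (conj_transpose (h' i j) ** h' i j)"

definition mac_noise ::
  "(nat \<Rightarrow> nat \<Rightarrow> complex ^ 'l ^ 1) \<Rightarrow> (nat \<Rightarrow> nat \<Rightarrow> real) \<Rightarrow> nat \<Rightarrow> nat \<Rightarrow> complex ^ 'l ^ 'l" where
  "mac_noise h' phi i j = mat 1 + (\<Sum>k\<in>{1..<j}. mac_gain h' phi i k)"

text \<open>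
  The diagonal matrix of MAC powers on tone i is given by its diagonal entries phi i 1, ...,
  phi i N; it is positive semidefinite iff these are nonnegative, and its trace is their sum.
\<close>

definition mac_objective ::
  "nat \<Rightarrow> nat \<Rightarrow> (nat \<Rightarrow> nat \<Rightarrow> complex ^ 'l ^ 1) \<Rightarrow> (nat \<Rightarrow> real) \<Rightarrow> real ^ 'l \<Rightarrow> real ^ 'l
   \<Rightarrow> (nat \<Rightarrow> nat \<Rightarrow> real) \<Rightarrow> real"
  where
  "mac_objective Nc N h w P lam phi =
     (let h' = scaled_channel h lam in
      (\<Sum>i = 1..Nc.
         (\<Sum>j = 1..N. w j * log 2 (Re (det (mat 1 +
            mac_gain h' phi i j ** matrix_inv (mac_noise h' phi i j)))))
         - (\<Sum>j = 1..N. phi i j))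
      + Re (trace (diag_sqrt lam ** diag_mat P ** diag_sqrt lam)))"

definition F_MAC_regular ::
  "nat \<Rightarrow> nat \<Rightarrow> (nat \<Rightarrow> nat \<Rightarrow> complex ^ 'l ^ 1) \<Rightarrow> (nat \<Rightarrow> real) \<Rightarrow> real ^ 'l \<Rightarrow> real ^ 'l \<Rightarrow> ereal"
  where
  "F_MAC_regular Nc N h w P lam =
     (SUP phi \<in> {phi. \<forall>i\<in>{1..Nc}. \<forall>j\<in>{1..N}. 0 \<le> phi i j}.
        ereal (mac_objective Nc N h w P lam phi))"

text \<open>
  The inverse square root of the multiplier matrix exists only if all multipliers are positive.
  If some multiplier is zero, the rescaled channel is understood as the limiting case of
  positive multipliers: lam is replaced by lam + e (in every component) and e tends to 0 from
  above. Totalised division (1 / 0 = 0) would instead switch the corresponding modem off.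
\<close>

definition F_MAC ::
  "nat \<Rightarrow> nat \<Rightarrow> (nat \<Rightarrow> nat \<Rightarrow> complex ^ 'l ^ 1) \<Rightarrow> (nat \<Rightarrow> real) \<Rightarrow> real ^ 'l \<Rightarrow> real ^ 'l \<Rightarrow> ereal"
  where
  "F_MAC Nc N h w P lam =
     (if \<forall>l. 0 < lam $ l then F_MAC_regular Nc N h w P lam
      else Lim (at_right 0) (\<lambda>e. F_MAC_regular Nc N h w P (lam + vec e)))"

end

(*
  Rates can be matched exactly, tone by tone and user by user. Absorb the multipliers into the
  channel, so that power is the plain trace, and let v_j be the conjugated row vector of user j.
  The matrix determinant lemma turns the multiple access rate into log (1 + phi_j c_j) with c_j
  = v_j^H B_j^-1 v_j. Given phi, beamforming along B_j^-1 v_j gives broadcast covariances with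
  the same ratios; given Q, prescribing the same ratios determines phi recursively. Neither
  passage increases the total power: by the optimality of B_j^-1 v_j (c_j B_j - v_j v_j^H is
  positive semidefinite) both power balances hold user by user up to interference terms, and
  these form the same double sum over k < j. Vanishing multipliers are reached by a limit,
  because the broadcast dual function is a supremum of affine functions and is essentially
  monotone in the multipliers.
*)

theory Submission
  imports Defs
begin

subsection \<open>Hermitian forms\<close>

text \<open>Conjugate-linear in the first argument, so \<open>cdot x (A *v x)\<close> is the form
  x^H A x whose real part occurs in \<open>psd\<close>.\<close>

definition cdot :: "complex ^ 'n \<Rightarrow> complex ^ 'n \<Rightarrow> complex" where
  "cdot x y = (\<Sum>k\<in>UNIV. cnj (x $ k) * y $ k)"

definition quad_form :: "complex ^ 'n ^ 'n \<Rightarrow> complex ^ 'n \<Rightarrow> real" where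
  "quad_form A x = Re (cdot x (A *v x))"

definition outer :: "complex ^ 'n \<Rightarrow> complex ^ 'n ^ 'n" where
  "outer x = (\<chi> i j. x $ i * cnj (x $ j))"

lemma cdot_add_right: "cdot x (y + z) = cdot x y + cdot x z"
  by (simp add: cdot_def algebra_simps sum.distrib)

lemma cdot_diff_right: "cdot x (y - z) = cdot x y - cdot x z"
  by (simp add: cdot_def algebra_simps sum_subtractf)

lemma cdot_diff_left: "cdot (x - y) z = cdot x z - cdot y z"
  by (simp add: cdot_def algebra_simps sum_subtractf)

lemma cdot_scale_right: "cdot x (c *s y) = c * cdot x y"
  by (simp add: cdot_def sum_distrib_left algebra_simps)

lemma cdot_scale_left: "cdot (c *s x) y = cnj c * cdot x y"
  by (simp add: cdot_def sum_distrib_left algebra_simps)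

lemma cdot_scaleR_right: "cdot x (c *\<^sub>R y) = c *\<^sub>R cdot x y"
  by (simp add: cdot_def scaleR_sum_right)

lemma cnj_cdot: "cnj (cdot x y) = cdot y x"
  by (simp add: cdot_def mult.commute)

lemma cdot_self: "cdot x x = of_real ((norm x)\<^sup>2)"
proof -
  have "(norm x)\<^sup>2 = (\<Sum>k\<in>UNIV. (cmod (x $ k))\<^sup>2)"
    by (simp add: norm_vec_def L2_set_def sum_nonneg)
  then show ?thesis
    by (simp add: cdot_def complex_norm_square mult.commute del: of_real_power)
qed

lemma cdot_adjoint: "cdot x (A *v y) = cdot (conj_transpose A *v x) y"
proof -
  have "cdot x (A *v y) = (\<Sum>i\<in>UNIV. \<Sum>j\<in>UNIV. cnj (x $ i) * (A $ i $ j * y $ j))"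
    by (simp add: cdot_def matrix_vector_mult_def sum_distrib_left)
  also have "\<dots> = (\<Sum>j\<in>UNIV. \<Sum>i\<in>UNIV. cnj (x $ i) * (A $ i $ j * y $ j))"
    by (rule sum.swap)
  also have "\<dots> = cdot (conj_transpose A *v x) y"
    by (simp add: cdot_def matrix_vector_mult_def conj_transpose_def sum_distrib_left sum_distrib_right
        mult_ac)
  finally show ?thesis .
qed

lemma scaleR_matrix_vector: "(c *\<^sub>R A) *v x = c *\<^sub>R (A *v (x :: complex ^ 'n))"
  by (simp add: vec_eq_iff matrix_vector_mult_def scaleR_sum_right)

lemma outer_mult_vec: "outer x *v y = cdot x y *s x"
  by (simp add: vec_eq_iff outer_def matrix_vector_mult_def cdot_def sum_distrib_left mult_ac)

lemma conj_transpose_add: "conj_transpose (A + B) = conj_transpose A + conj_transpose B"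
  by (simp add: vec_eq_iff conj_transpose_def)

lemma conj_transpose_diff: "conj_transpose (A - B) = conj_transpose A - conj_transpose B"
  by (simp add: vec_eq_iff conj_transpose_def)

lemma conj_transpose_scaleR: "conj_transpose (c *\<^sub>R A) = c *\<^sub>R conj_transpose A"
  by (simp add: vec_eq_iff conj_transpose_def)

lemma conj_transpose_sum: "conj_transpose (\<Sum>k\<in>K. A k) = (\<Sum>k\<in>K. conj_transpose (A k))"
  by (simp add: vec_eq_iff conj_transpose_def)

lemma conj_transpose_mat_1: "conj_transpose (mat 1) = mat 1"
  by (simp add: vec_eq_iff conj_transpose_def mat_def)

lemma conj_transpose_outer: "conj_transpose (outer x) = outer x"
  by (simp add: vec_eq_iff conj_transpose_def outer_def)

lemma conj_transpose_mult: "conj_transpose (A ** B) = conj_transpose B ** conj_transpose A"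
  by (simp add: vec_eq_iff conj_transpose_def matrix_matrix_mult_def mult.commute)

lemma conj_transpose_diag_mat: "conj_transpose (diag_mat v) = diag_mat v"
  by (simp add: vec_eq_iff conj_transpose_def diag_mat_def)

lemma quad_form_add: "quad_form (A + B) x = quad_form A x + quad_form B x"
  by (simp add: quad_form_def matrix_vector_mult_add_rdistrib cdot_add_right)

lemma quad_form_diff: "quad_form (A - B) x = quad_form A x - quad_form B x"
  by (simp add: quad_form_def matrix_vector_mult_diff_rdistrib cdot_diff_right)

lemma quad_form_scaleR: "quad_form (c *\<^sub>R A) x = c * quad_form A x"
  by (simp add: quad_form_def scaleR_matrix_vector cdot_scaleR_right)

lemma quad_form_zero: "quad_form 0 x = 0"
  by (simp add: quad_form_def cdot_def matrix_vector_mult_def)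

lemma quad_form_sum: "quad_form (\<Sum>k\<in>K. A k) x = (\<Sum>k\<in>K. quad_form (A k) x)"
  by (induction K rule: infinite_finite_induct) (simp_all add: quad_form_zero quad_form_add)

lemma quad_form_mat_1: "quad_form (mat 1) x = (norm x)\<^sup>2"
  by (simp add: quad_form_def cdot_self)

lemma quad_form_outer: "quad_form (outer y) x = (cmod (cdot y x))\<^sup>2"
proof -
  have "cdot x (outer y *v x) = cdot y x * cnj (cdot y x)"
    by (simp add: outer_mult_vec cdot_scale_right cnj_cdot)
  then show ?thesis
    unfolding quad_form_def cmod_power2 by (simp add: power2_eq_square)
qed

lemma psd_iff: "psd A \<longleftrightarrow> conj_transpose A = A \<and> (\<forall>x. 0 \<le> quad_form A x)"
  by (simp add: psd_def quad_form_def cdot_def)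

lemma hermitian_cdot:
  assumes "conj_transpose A = A"
  shows "cdot x (A *v x) = of_real (quad_form A x)"
proof -
  have "cnj (cdot x (A *v x)) = cdot x (A *v x)"
    using assms by (metis cdot_adjoint cnj_cdot)
  then show ?thesis
    by (simp add: quad_form_def complex_eq_iff)
qed

text \<open>Expanding the nonnegative form at x - s y gives a real quadratic bound in the complex
  parameter s. Since A is only semidefinite, the form may vanish at y, and that case is treated
  separately.\<close>

lemma psd_Cauchy_Schwarz:
  assumes "psd A"
  shows "(cmod (cdot y (A *v x)))\<^sup>2 \<le> quad_form A y * quad_form A x"
proof -
  have A: "conj_transpose A = A" "\<And>x. 0 \<le> quad_form A x"
    using assms by (auto simp: psd_iff)
  define z where "z = cdot y (A *v x)"
  have zc: "cdot x (A *v y) = cnj z"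
    unfolding z_def by (metis A(1) cdot_adjoint cnj_cdot)
  have ineq: "0 \<le> quad_form A x - 2 * Re (cnj s * z) + (cmod s)\<^sup>2 * quad_form A y" for s
  proof -
    have "cdot (x - s *s y) (A *v (x - s *s y)) =
        cdot x (A *v x) - (s * cnj z + cnj s * z) + (s * cnj s) * cdot y (A *v y)"
      by (simp add: matrix_vector_mult_diff_distrib vector_scalar_commute cdot_diff_right
          cdot_diff_left cdot_scale_left cdot_scale_right zc algebra_simps flip: z_def)
    then have "quad_form A (x - s *s y) =
        quad_form A x - Re (s * cnj z + cnj s * z) + Re ((s * cnj s) * cdot y (A *v y))"
      by (simp add: quad_form_def)
    also have "Re (s * cnj z + cnj s * z) = 2 * Re (cnj s * z)"
      by simp
    also have "Re ((s * cnj s) * cdot y (A *v y)) = (cmod s)\<^sup>2 * quad_form A y"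
      by (simp add: hermitian_cdot[OF A(1)] flip: complex_norm_square)
    finally show ?thesis using A(2)[of "x - s *s y"] by simp
  qed
  show ?thesis
  proof (cases "quad_form A y = 0")
    case True
    have "z = 0"
    proof (rule ccontr)
      assume "z \<noteq> 0"
      \<comment> \<open>With no quadratic term left, a large multiple s = r z violates the bound;
        this r makes its right-hand side equal to -1.\<close>
      define r where "r = (quad_form A x + 1) / (2 * (cmod z)\<^sup>2)"
      have "Re (cnj (of_real r * z) * z) = r * (cmod z)\<^sup>2"
        unfolding cmod_power2 by (simp add: power2_eq_square algebra_simps)
      then have "0 \<le> quad_form A x - 2 * (r * (cmod z)\<^sup>2)"
        using ineq[of "of_real r * z"] True by simp
      then show False
        using \<open>z \<noteq> 0\<close> by (simp add: r_def field_simps)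
    qed
    then show ?thesis by (simp add: True flip: z_def)
  next
    case False
    then have pos: "quad_form A y > 0" using A(2)[of y] by simp
    \<comment> \<open>The minimising parameter is s = z / \<open>quad_form A y\<close>.\<close>
    define r where "r = 1 / quad_form A y"
    have "Re (cnj (of_real r * z) * z) = r * (cmod z)\<^sup>2"
      unfolding cmod_power2 by (simp add: power2_eq_square algebra_simps)
    then have "0 \<le> quad_form A x - 2 * (r * (cmod z)\<^sup>2) + (r * cmod z)\<^sup>2 * quad_form A y"
      using ineq[of "of_real r * z"] by (simp add: norm_mult power_mult_distrib)
    then have "0 \<le> quad_form A x - (cmod z)\<^sup>2 / quad_form A y"
      using pos by (simp add: r_def field_simps power2_eq_square)
    then show ?thesis
      using pos by (simp add: field_simps flip: z_def)
  qed
qed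

section \<open>Traces of products of positive semidefinite matrices\<close>

lemma trace_mult_outer: "trace (A ** outer x) = cdot x (A *v x)"
  by (simp add: trace_def outer_def matrix_matrix_mult_def cdot_def matrix_vector_mult_def
      sum_distrib_left mult_ac)

lemma trace_scaleR: "trace (c *\<^sub>R A) = c *\<^sub>R trace (A :: complex ^ 'n ^ 'n)"
  by (simp add: trace_def scaleR_sum_right)

lemma matrix_mult_scaleR: "A ** (c *\<^sub>R B) = c *\<^sub>R (A ** (B :: complex ^ 'n ^ 'm))"
  by (simp add: vec_eq_iff matrix_matrix_mult_def scaleR_sum_right)

lemma cdot_axis: "cdot (axis k 1) x = x $ k"
  by (simp add: cdot_def axis_def if_distrib if_distribR cong: if_cong)

lemma matrix_mult_axis: "((A :: complex ^ 'n ^ 'm) *v axis l 1) $ k = A $ k $ l"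
  by (simp add: matrix_vector_mult_def axis_def if_distrib cong: if_cong)

lemma psd_outer: "0 \<le> c \<Longrightarrow> psd (c *\<^sub>R outer x)"
  by (simp add: psd_iff conj_transpose_scaleR conj_transpose_outer quad_form_scaleR quad_form_outer)

text \<open>Cholesky elimination, by induction on the number of nonzero diagonal entries of Q. A
  nonzero pivot q with its column y splits off the rank-one matrix y y^H / q, whose contribution to
  the trace is a value of the form of A divided by q. The remainder is a Schur complement; its
  semidefiniteness is Cauchy-Schwarz for the k-th unit vector and x.\<close>

lemma psd_trace_mult_nonneg:
  fixes A Q :: "complex ^ 'n ^ 'n"
  assumes A: "psd A" and Q: "psd Q"
  shows "0 \<le> Re (trace (A ** Q))"
  using Q
proof (induction "card {k. Q $ k $ k \<noteq> 0}" arbitrary: Q rule: less_induct)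
  case less
  have herm: "conj_transpose Q = Q" and nonneg: "\<And>x. 0 \<le> quad_form Q x"
    using less.prems by (auto simp: psd_iff)
  have entry: "cdot (axis k 1) (Q *v axis l 1) = Q $ k $ l" for k l
    by (simp add: cdot_axis matrix_mult_axis)
  have diag: "Q $ k $ k = of_real (quad_form Q (axis k 1))" for k
    using hermitian_cdot[OF herm, of "axis k 1"] by (simp add: entry)
  have CS: "(cmod (Q $ k $ l))\<^sup>2 \<le> quad_form Q (axis k 1) * quad_form Q (axis l 1)" for k l
    using psd_Cauchy_Schwarz[OF less.prems, of "axis k 1" "axis l 1"] by (simp add: entry)
  show ?case
  proof (cases "\<exists>k. Q $ k $ k \<noteq> 0")
    case False
    \<comment> \<open>By Cauchy-Schwarz, a zero diagonal entry annihilates its entire row and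
      column.\<close>
    then have "Q = 0"
      using CS diag by (simp add: vec_eq_iff)
    then show ?thesis by (simp add: trace_def matrix_matrix_mult_def)
  next
    case True
    then obtain k where k: "Q $ k $ k \<noteq> 0" by blast
    define q where "q = quad_form Q (axis k 1)"
    have q: "q > 0" using k diag[of k] nonneg[of "axis k 1"] by (simp add: q_def less_le)
    define y where "y = Q *v axis k 1"
    have y: "y $ l = Q $ l $ k" for l
      by (simp add: y_def matrix_mult_axis)
    define R where "R = Q - (1 / q) *\<^sub>R outer y"
    have "0 \<le> quad_form R x" for x
    proof -
      have "cdot y x = cdot (axis k 1) (Q *v x)"
        by (simp add: y_def cdot_adjoint herm)
      then have "(cmod (cdot y x))\<^sup>2 \<le> q * quad_form Q x"
        using psd_Cauchy_Schwarz[OF less.prems, of "axis k 1" x] by (simp add: q_def)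
      then show ?thesis
        using q by (simp add: R_def quad_form_diff quad_form_scaleR quad_form_outer field_simps)
    qed
    then have psdR: "psd R"
      by (simp add: psd_iff R_def conj_transpose_diff conj_transpose_scaleR conj_transpose_outer herm)
    have Rkk: "R $ k $ k = 0"
      using q diag[of k] by (simp add: R_def outer_def y flip: q_def)
        (simp add: scaleR_conv_of_real)
    \<comment> \<open>Zero diagonal entries stay zero, and the pivot entry becomes zero, so the
      induction measure drops strictly.\<close>
    have "R $ l $ l = 0" if "Q $ l $ l = 0" for l
    proof -
      have "quad_form Q (axis l 1) = 0" using that diag[of l] by simp
      then have "Q $ l $ k = 0" using CS[of l k] by simp
      then show ?thesis using that by (simp add: R_def outer_def y)
    qed
    then have "{l. R $ l $ l \<noteq> 0} \<subset> {l. Q $ l $ l \<noteq> 0}"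
      using k Rkk by blast
    then have "0 \<le> Re (trace (A ** R))"
      using less.hyps psdR by (meson finite psubset_card_mono)
    moreover have "A ** Q = A ** R + (1 / q) *\<^sub>R (A ** outer y)"
      by (simp add: R_def matrix_mult_scaleR[symmetric] flip: matrix_add_ldistrib)
    ultimately show ?thesis
      using q A by (simp add: trace_add trace_scaleR trace_mult_outer psd_iff flip: quad_form_def)
  qed
qed

subsection \<open>The matrix determinant lemma\<close>

text \<open>The rows e_i + x_i y are introduced one at a time. By linearity in row k, each new row
  adds x_k times a determinant having y itself as row k.\<close>

lemma det_identity_plus_rank_one:
  fixes x y :: "'a::field ^ 'n"
  shows "det (mat 1 + (\<chi> i j. x $ i * y $ j)) = 1 + (\<Sum>i\<in>UNIV. x $ i * y $ i)"
proof -
  define e :: "'n \<Rightarrow> 'a ^ 'n" where "e i = axis i 1" for i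
  have row_mat: "row i (mat 1) = e i" for i
    by (simp add: e_def row_def mat_def axis_def vec_eq_iff)
  \<comment> \<open>Once row k is y, row operations remove the multiples of y from all other rows.
    What remains is the identity with row k replaced by y, which Cramer's rule evaluates.\<close>
  have replaced: "det (\<chi> i. if i = k then y else if i \<in> S then e i + x $ i *s y else e i) = y $ k"
    if "k \<notin> S" for k S
    using finite[of S] that
  proof (induction S rule: finite_induct)
    case empty
    have y: "y = (\<Sum>i\<in>UNIV. y $ i *s row i (mat 1))"
      by (simp add: row_mat e_def vec_eq_iff axis_def if_distrib cong: if_cong)
    have "det (\<chi> i. if i = k then y else row i (mat 1)) = y $ k"
      using cramer_lemma_transpose[of k y "mat 1 :: 'a ^ 'n ^ 'n"]
      unfolding y[symmetric] det_I mult_1_right .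
    then show ?case
      by (simp add: row_mat cong: if_cong)
  next
    case (insert m S)
    let ?A = "\<chi> i. if i = k then y else if i \<in> S then e i + x $ i *s y else e i"
    have "(\<chi> i. if i = k then y else if i \<in> insert m S then e i + x $ i *s y else e i) =
        (\<chi> i. if i = m then row m ?A + x $ m *s row k ?A else row i ?A)"
      using insert by (auto simp: vec_eq_iff row_def)
    then show ?case
      using insert det_row_operation[of m k ?A "x $ m"] by auto
  qed
  have replaced_rows: "det (\<chi> i. if i \<in> S then e i + x $ i *s y else e i) = 1 + (\<Sum>i\<in>S. x $ i * y $ i)" for S
    using finite[of S]
  proof (induction S rule: finite_induct)
    case empty
    have "(\<chi> i. e i) = mat 1"
      by (simp add: e_def mat_def axis_def vec_eq_iff)
    then show ?case by simp
  next
    case (insert k S)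
    let ?c = "\<lambda>i. if i \<in> S then e i + x $ i *s y else e i"
    have "det (\<chi> i. if i \<in> insert k S then e i + x $ i *s y else e i) =
        det (\<chi> i. if i = k then e i + x $ i *s y else ?c i)"
      by (intro arg_cong[where f = det]) (simp add: vec_eq_iff)
    also have "\<dots> = det (\<chi> i. if i = k then e i else ?c i) + det (\<chi> i. if i = k then x $ i *s y else ?c i)"
      by (rule det_row_add)
    also have "(\<chi> i. if i = k then e i else ?c i) = (\<chi> i. ?c i)"
      using insert by (simp add: vec_eq_iff)
    also have "det (\<chi> i. if i = k then x $ i *s y else ?c i) =
        det (\<chi> i. if i = k then x $ k *s y else ?c i)"
      by (intro arg_cong[where f = det]) (simp add: vec_eq_iff)
    also have "\<dots> = x $ k * det (\<chi> i. if i = k then y else ?c i)"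
      by (rule det_row_mul)
    finally show ?case
      using insert replaced[of k S] by simp
  qed
  have "mat 1 + (\<chi> i j. x $ i * y $ j) = (\<chi> i. if i \<in> UNIV then e i + x $ i *s y else e i)"
    by (simp add: vec_eq_iff e_def mat_def axis_def)
  then show ?thesis
    using replaced_rows[of UNIV] by (simp only:)
qed

text \<open>\<open>matrix_inv\<close> is a choice, so an explicit two-sided inverse is identified
  with it by uniqueness.\<close>

lemma matrix_inv_eqI:
  fixes A B :: "'a::semiring_1 ^ 'n ^ 'n"
  assumes "A ** B = mat 1" "B ** A = mat 1"
  shows "matrix_inv A = B"
proof -
  have inv: "A ** matrix_inv A = mat 1 \<and> matrix_inv A ** A = mat 1"
    unfolding matrix_inv_def
    by (rule someI[where P = "\<lambda>A'. A ** A' = mat 1 \<and> A' ** A = mat 1" and x = B])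
      (simp add: assms)
  have "matrix_inv A = (B ** A) ** matrix_inv A"
    by (simp only: assms matrix_mul_lid)
  also have "\<dots> = B ** (A ** matrix_inv A)"
    by (simp only: matrix_mul_assoc)
  also have "\<dots> = B"
    by (simp only: inv matrix_mul_rid)
  finally show ?thesis .
qed

subsection \<open>Duality for unit multipliers on one tone\<close>

text \<open>Noise plus interference seen by user j at the receiver of one tone. User 1 is decoded
  last, so the users k < j are still undecoded.\<close>

definition mac_cov :: "(nat \<Rightarrow> complex ^ 'n) \<Rightarrow> (nat \<Rightarrow> real) \<Rightarrow> nat \<Rightarrow> complex ^ 'n ^ 'n" where
  "mac_cov v phi j = mat 1 + (\<Sum>k\<in>{1..<j}. phi k *\<^sub>R outer (v k))"

text \<open>The MMSE receive direction B_j^-1 v_j, which serves as the transmit beam of user j in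
  the broadcast channel.\<close>

definition mmse_filter :: "(nat \<Rightarrow> complex ^ 'n) \<Rightarrow> (nat \<Rightarrow> real) \<Rightarrow> nat \<Rightarrow> complex ^ 'n" where
  "mmse_filter v phi j = matrix_inv (mac_cov v phi j) *v v j"

text \<open>The signal-to-noise ratio v_j^H B_j^-1 v_j that user j obtains per unit of transmit
  power.\<close>

definition mmse_gain :: "(nat \<Rightarrow> complex ^ 'n) \<Rightarrow> (nat \<Rightarrow> real) \<Rightarrow> nat \<Rightarrow> real" where
  "mmse_gain v phi j = quad_form (matrix_inv (mac_cov v phi j)) (v j)"

lemma quad_form_mac_cov:
  "quad_form (mac_cov v phi j) x = (norm x)\<^sup>2 + (\<Sum>k\<in>{1..<j}. phi k * (cmod (cdot (v k) x))\<^sup>2)"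
  by (simp add: mac_cov_def quad_form_add quad_form_sum quad_form_scaleR quad_form_mat_1 quad_form_outer)

lemma hermitian_mac_cov: "conj_transpose (mac_cov v phi j) = mac_cov v phi j"
  by (simp add: mac_cov_def conj_transpose_add conj_transpose_mat_1 conj_transpose_sum
      conj_transpose_scaleR conj_transpose_outer)

lemma matrix_add_mult_distrib: "(A + B) ** C = A ** C + B ** (C :: complex ^ 'n ^ 'm)"
  by (simp add: vec_eq_iff matrix_matrix_mult_def distrib_right sum.distrib)

lemma trace_sum_mult: "trace ((\<Sum>k\<in>K. A k) ** B) = (\<Sum>k\<in>K. trace (A k ** (B :: complex ^ 'n ^ 'n)))"
proof -
  have "0 ** B = 0" for B :: "complex ^ 'n ^ 'n"
    by (simp add: vec_eq_iff matrix_matrix_mult_def)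
  moreover have "trace (0 :: complex ^ 'n ^ 'n) = 0"
    by (simp add: trace_def)
  ultimately show ?thesis
    by (induction K rule: infinite_finite_induct) (simp_all add: matrix_add_mult_distrib trace_add)
qed

text \<open>Separates the transmit power of a broadcast covariance from the weighted interference it
  causes; these are the terms that \<open>power_balance\<close> sums over the users.\<close>

lemma trace_mac_cov_mult:
  "Re (trace (mac_cov v phi j ** Q)) = Re (trace Q) + (\<Sum>k\<in>{1..<j}. phi k * quad_form Q (v k))"
proof -
  have "trace (outer x ** Q) = cdot x (Q *v x)" for x
    by (simp only: trace_mul_sym[of "outer x"] trace_mult_outer)
  then show ?thesis
    by (simp add: mac_cov_def matrix_add_mult_distrib trace_add trace_sum_mult scalar_matrix_assoc[symmetric] trace_scaleR
        quad_form_def)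
qed

context
  fixes v :: "nat \<Rightarrow> complex ^ 'n" and phi :: "nat \<Rightarrow> real" and j :: nat
  assumes phi_nonneg: "\<And>k. k \<in> {1..<j} \<Longrightarrow> 0 \<le> phi k"
begin

text \<open>The identity noise makes the covariance definite. Its kernel is therefore trivial, which
  yields the inverse in \<open>mac_cov_inverse\<close>.\<close>

lemma quad_form_mac_cov_ge: "(norm x)\<^sup>2 \<le> quad_form (mac_cov v phi j) x"
  using phi_nonneg by (auto simp: quad_form_mac_cov intro!: sum_nonneg mult_nonneg_nonneg)

lemma psd_mac_cov: "psd (mac_cov v phi j)"
  unfolding psd_iff
  by (intro conjI allI hermitian_mac_cov order_trans[OF zero_le_power2 quad_form_mac_cov_ge])

lemma mac_cov_inverse: "mac_cov v phi j ** matrix_inv (mac_cov v phi j) = mat 1"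
proof -
  have "x = 0" if "mac_cov v phi j *v x = 0" for x
    using that quad_form_mac_cov_ge[of x] by (simp add: quad_form_def cdot_def)
  then obtain B where left: "B ** mac_cov v phi j = mat 1"
    using matrix_left_invertible_ker[of "mac_cov v phi j"] by blast
  then have right: "mac_cov v phi j ** B = mat 1"
    by (rule matrix_left_right_inverse1)
  show ?thesis
    unfolding matrix_inv_eqI[OF right left] by (rule right)
qed

lemma mac_cov_mmse_filter: "mac_cov v phi j *v mmse_filter v phi j = v j"
  unfolding mmse_filter_def matrix_vector_mul_assoc mac_cov_inverse by simp

lemma cdot_mmse_filter: "cdot (v j) (mmse_filter v phi j) = of_real (mmse_gain v phi j)"
proof -
  let ?u = "mmse_filter v phi j"
  have "cdot (v j) ?u = cdot ?u (mac_cov v phi j *v ?u)"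
    by (subst cdot_adjoint) (simp only: hermitian_mac_cov mac_cov_mmse_filter)
  also have "\<dots> = of_real (quad_form (mac_cov v phi j) ?u)"
    by (rule hermitian_cdot[OF hermitian_mac_cov])
  finally have "cdot (v j) ?u = of_real (quad_form (mac_cov v phi j) ?u)" .
  moreover have "mmse_gain v phi j = Re (cdot (v j) ?u)"
    by (simp add: mmse_gain_def mmse_filter_def quad_form_def)
  ultimately show ?thesis by (metis Re_complex_of_real)
qed

lemma mmse_gain_eq: "mmse_gain v phi j = quad_form (mac_cov v phi j) (mmse_filter v phi j)"
proof -
  have "cdot (mmse_filter v phi j) (v j) = of_real (mmse_gain v phi j)"
    by (subst cnj_cdot[symmetric]) (simp only: cdot_mmse_filter complex_cnj_complex_of_real)
  then show ?thesis
    by (simp only: quad_form_def mac_cov_mmse_filter Re_complex_of_real)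
qed

lemma mmse_gain_nonneg: "0 \<le> mmse_gain v phi j"
  unfolding mmse_gain_eq using psd_mac_cov by (simp only: psd_iff)

text \<open>A vanishing gain means a vanishing channel, which settles the division by zero in
  \<open>ex_mac_powers\<close>.\<close>

lemma mmse_gain_zero:
  assumes "mmse_gain v phi j = 0"
  shows "v j = 0"
proof -
  have "mmse_filter v phi j = 0"
    using quad_form_mac_cov_ge[of "mmse_filter v phi j"] assms by (simp flip: mmse_gain_eq)
  then show ?thesis
    using mac_cov_mmse_filter by simp
qed

text \<open>The maximal signal-to-noise ratio over all receive filters is attained by the MMSE filter.\<close>

lemma psd_mmse: "psd (mmse_gain v phi j *\<^sub>R mac_cov v phi j - outer (v j))"
proof -
  have "(cmod (cdot (v j) x))\<^sup>2 \<le> mmse_gain v phi j * quad_form (mac_cov v phi j) x" for x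
  proof -
    have "cdot (v j) x = cdot (mmse_filter v phi j) (mac_cov v phi j *v x)"
      by (simp add: cdot_adjoint hermitian_mac_cov mac_cov_mmse_filter)
    then show ?thesis
      unfolding mmse_gain_eq using psd_Cauchy_Schwarz[OF psd_mac_cov] by (simp only:)
  qed
  then show ?thesis
    by (simp add: psd_iff conj_transpose_diff conj_transpose_scaleR hermitian_mac_cov
        conj_transpose_outer quad_form_diff quad_form_scaleR quad_form_outer)
qed

text \<open>Pairing the semidefinite matrix of \<open>psd_mmse\<close> with Q inside a trace extends
  the optimality of the MMSE filter from single beams to arbitrary covariances.\<close>

lemma quad_form_le_mmse_gain_trace:
  assumes "psd Q"
  shows "quad_form Q (v j) \<le> mmse_gain v phi j * Re (trace (mac_cov v phi j ** Q))"
proof -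
  let ?M = "mmse_gain v phi j *\<^sub>R mac_cov v phi j - outer (v j)"
  have "?M ** Q + outer (v j) ** Q = mmse_gain v phi j *\<^sub>R (mac_cov v phi j ** Q)"
    by (simp only: matrix_add_mult_distrib[symmetric] scalar_matrix_assoc diff_add_cancel)
  then have "trace (?M ** Q) + trace (outer (v j) ** Q) = mmse_gain v phi j *\<^sub>R trace (mac_cov v phi j ** Q)"
    by (simp only: trace_add[symmetric] trace_scaleR[symmetric])
  moreover have "trace (outer (v j) ** Q) = cdot (v j) (Q *v v j)"
    by (simp only: trace_mul_sym[of "outer (v j)"] trace_mult_outer)
  ultimately have "Re (trace (?M ** Q) + cdot (v j) (Q *v v j)) =
      Re (mmse_gain v phi j *\<^sub>R trace (mac_cov v phi j ** Q))"
    by (simp only:)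
  then have "Re (trace (?M ** Q)) + quad_form Q (v j) =
      mmse_gain v phi j * Re (trace (mac_cov v phi j ** Q))"
    by (simp only: quad_form_def plus_complex.sel scaleR_complex.sel)
  then show ?thesis
    using psd_trace_mult_nonneg[OF psd_mmse assms] by linarith
qed

end

text \<open>User 1 is encoded first, so only the later encoded users k > j disturb user j; the
  leading 1 is the noise.\<close>

definition bc_interference :: "nat \<Rightarrow> (nat \<Rightarrow> complex ^ 'n) \<Rightarrow> (nat \<Rightarrow> complex ^ 'n ^ 'n) \<Rightarrow> nat \<Rightarrow> real" where
  "bc_interference N v Q j = 1 + (\<Sum>k=j+1..N. quad_form (Q k) (v j))"

text \<open>
  Both sides of the duality satisfy the same power balance: user k disturbs user j in the
  multiple access channel exactly when user j disturbs user k in the broadcast channel.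
\<close>

lemma power_balance:
  "(\<Sum>j=1..N. phi j * bc_interference N v Q j) =
    (\<Sum>j=1..N. phi j) + (\<Sum>j=1..N. \<Sum>k\<in>{1..<j}. phi k * quad_form (Q j) (v k))"
proof -
  have "(\<Sum>j=1..N. \<Sum>k\<in>{1..<j}. phi k * quad_form (Q j) (v k)) =
      (\<Sum>j=1..N. \<Sum>k\<in>{k\<in>{1..N}. k < j}. phi k * quad_form (Q j) (v k))"
    by (intro sum.cong) auto
  also have "\<dots> = (\<Sum>k=1..N. \<Sum>j\<in>{j\<in>{1..N}. k < j}. phi k * quad_form (Q j) (v k))"
    by (rule sum.swap_restrict) simp_all
  also have "\<dots> = (\<Sum>k=1..N. \<Sum>j=k+1..N. phi k * quad_form (Q j) (v k))"
    by (intro sum.cong) auto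
  finally show ?thesis
    by (simp add: bc_interference_def sum_distrib_left distrib_left sum.distrib)
qed

text \<open>User j transmits along its MMSE filter, with the power that produces the prescribed
  ratio. Its interference involves only users k > j, so the covariances are found from user N
  downwards.\<close>

lemma ex_bc_covariances:
  fixes v :: "nat \<Rightarrow> complex ^ 'n"
  assumes phi: "\<And>j. j \<in> {1..N} \<Longrightarrow> 0 \<le> phi j"
  obtains Q where "\<And>j. j \<in> {1..N} \<Longrightarrow> psd (Q j)"
    and "\<And>j. j \<in> {1..N} \<Longrightarrow>
      quad_form (Q j) (v j) / bc_interference N v Q j = phi j * mmse_gain v phi j"
    and "(\<Sum>j=1..N. Re (trace (Q j))) \<le> (\<Sum>j=1..N. phi j)"
proof -
  define c where "c = mmse_gain v phi"
  define u where "u = mmse_filter v phi"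
  define F where "F Q j = (phi j * bc_interference N v Q j / c j) *\<^sub>R outer (u j)" for Q j
  \<comment> \<open>\<open>F Q j\<close> reads \<open>Q\<close> only at k in j+1..N, where N - k < N
    - j; the recursion therefore has a fixed point.\<close>
  have "adm_wf (Wellfounded.measure (\<lambda>j. N - j)) F"
    unfolding adm_wf_def F_def bc_interference_def
    by (auto intro!: sum.cong arg_cong2[where f = scaleR] arg_cong2[where f = "(*)"]
        arg_cong2[where f = "(/)"])
  then obtain Q where Q_fix: "Q = F Q"
    using wfrec_fixpoint[OF wf_measure] by blast
  have Q: "Q j = (phi j * bc_interference N v Q j / c j) *\<^sub>R outer (u j)" for j
    by (subst Q_fix) (simp add: F_def)
  have prefix: "0 \<le> phi k" if "k \<in> {1..<j}" "j \<in> {1..N}" for j k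
    using that phi by auto
  have gain: "0 \<le> mmse_gain v phi j" if "j \<in> {1..N}" for j
    by (rule mmse_gain_nonneg) (use prefix that in blast)
  have "psd (Q j) \<and> 1 \<le> bc_interference N v Q j" if "j \<in> {1..N}" for j
    using that
  proof (induction "N - j" arbitrary: j rule: less_induct)
    case less
    have "psd (Q k)" if "k \<in> {j+1..N}" for k
      using less that by auto
    then have pos: "1 \<le> bc_interference N v Q j"
      by (auto simp: bc_interference_def psd_iff intro!: sum_nonneg)
    moreover have "psd (Q j)"
      using pos gain[of j] phi[of j] less.prems
      by (subst Q) (auto intro!: psd_outer divide_nonneg_nonneg mult_nonneg_nonneg simp: c_def)
    ultimately show ?case by blast
  qed
  then have psdQ: "psd (Q j)" and pos: "1 \<le> bc_interference N v Q j" if "j \<in> {1..N}" for j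
    using that by auto
  \<comment> \<open>If c_j = 0, division by zero makes \<open>Q j\<close> zero, and both sides
    vanish.\<close>
  have ratio: "quad_form (Q j) (v j) / bc_interference N v Q j = phi j * c j" if j: "j \<in> {1..N}" for j
  proof -
    have "cdot (u j) (v j) = of_real (c j)"
      unfolding c_def u_def
      by (subst cnj_cdot[symmetric], subst cdot_mmse_filter) (use prefix j in auto)
    then have "quad_form (Q j) (v j) = phi j * bc_interference N v Q j / c j * (c j)\<^sup>2"
      by (subst Q) (simp add: quad_form_scaleR quad_form_outer)
    then show ?thesis
      using pos[OF j] by (simp add: power2_eq_square)
  qed
  have "Re (trace (Q j)) + (\<Sum>k\<in>{1..<j}. phi k * quad_form (Q j) (v k))
      \<le> phi j * bc_interference N v Q j" if j: "j \<in> {1..N}" for j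
  proof -
    have "Re (trace (mac_cov v phi j ** Q j)) =
        phi j * bc_interference N v Q j / c j * quad_form (mac_cov v phi j) (u j)"
      by (subst Q) (simp add: matrix_mult_scaleR trace_scaleR trace_mult_outer quad_form_def)
    also have "\<dots> = phi j * bc_interference N v Q j / c j * c j"
      unfolding c_def u_def by (subst (2) mmse_gain_eq) (use prefix j in auto)
    \<comment> \<open>An equality unless c_j = 0, in which case the left side is 0.\<close>
    also have "\<dots> \<le> phi j * bc_interference N v Q j"
      using pos[OF j] phi[OF j] by simp
    finally show ?thesis by (simp only: trace_mac_cov_mult)
  qed
  then have "(\<Sum>j=1..N. Re (trace (Q j)) + (\<Sum>k\<in>{1..<j}. phi k * quad_form (Q j) (v k)))
      \<le> (\<Sum>j=1..N. phi j * bc_interference N v Q j)"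
    by (rule sum_mono)
  then have "(\<Sum>j=1..N. Re (trace (Q j))) \<le> (\<Sum>j=1..N. phi j)"
    unfolding sum.distrib power_balance by simp
  then show thesis
    by (intro that[of Q]) (use psdQ ratio[unfolded c_def] in blast)+
qed

text \<open>The gain of user j depends only on the powers of users k < j, so the prescribed ratios
  determine the powers upwards from user 1. The power bound comes from
  \<open>quad_form_le_mmse_gain_trace\<close>: no covariance achieves the ratio more cheaply than
  the MMSE beam.\<close>

lemma ex_mac_powers:
  fixes v :: "nat \<Rightarrow> complex ^ 'n"
  assumes psdQ: "\<And>j. j \<in> {1..N} \<Longrightarrow> psd (Q j)"
  obtains phi where "\<And>j. j \<in> {1..N} \<Longrightarrow> 0 \<le> phi j"
    and "\<And>j. j \<in> {1..N} \<Longrightarrow>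
      quad_form (Q j) (v j) / bc_interference N v Q j = phi j * mmse_gain v phi j"
    and "(\<Sum>j=1..N. phi j) \<le> (\<Sum>j=1..N. Re (trace (Q j)))"
proof -
  define a where "a = bc_interference N v Q"
  define F where "F phi j = quad_form (Q j) (v j) / a j / mmse_gain v phi j" for phi j
  have "adm_wf (Wellfounded.measure (\<lambda>j. j)) F"
    unfolding adm_wf_def
  proof (intro allI impI)
    fix f g :: "nat \<Rightarrow> real" and j
    assume "\<forall>k. (k, j) \<in> Wellfounded.measure (\<lambda>j. j) \<longrightarrow> f k = g k"
    then have "mac_cov v f j = mac_cov v g j"
      by (simp add: mac_cov_def)
    then show "F f j = F g j"
      by (simp add: F_def mmse_gain_def)
  qed
  then obtain phi where phi_fix: "phi = F phi"
    using wfrec_fixpoint[OF wf_measure] by blast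
  have phi: "phi j = quad_form (Q j) (v j) / a j / mmse_gain v phi j" for j
    by (subst phi_fix) (simp add: F_def)
  have a: "1 \<le> a j" if "j \<in> {1..N}" for j
    using psdQ by (auto simp: a_def bc_interference_def psd_iff intro!: sum_nonneg)
  have nonneg: "0 \<le> phi j" if "j \<in> {1..N}" for j
    using that
  proof (induction j rule: less_induct)
    case (less j)
    then have "0 \<le> mmse_gain v phi j"
      by (intro mmse_gain_nonneg) auto
    then show ?case
      using a[of j] psdQ[of j] less.prems
      by (subst phi) (auto intro!: divide_nonneg_nonneg simp: psd_iff)
  qed
  have prefix: "0 \<le> phi k" if "k \<in> {1..<j}" "j \<in> {1..N}" for j k
    using that nonneg by auto
  have ratio: "quad_form (Q j) (v j) / a j = phi j * mmse_gain v phi j" if j: "j \<in> {1..N}" for j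
  proof (cases "mmse_gain v phi j = 0")
    case True
    have "v j = 0"
      by (rule mmse_gain_zero[OF _ True]) (use prefix j in blast)
    then show ?thesis
      using True by (simp add: quad_form_def cdot_def)
  next
    case False
    then show ?thesis by (subst phi) simp
  qed
  have "phi j * a j \<le> Re (trace (Q j)) + (\<Sum>k\<in>{1..<j}. phi k * quad_form (Q j) (v k))"
    if j: "j \<in> {1..N}" for j
  proof (cases "mmse_gain v phi j = 0")
    case True
    \<comment> \<open>Division by zero assigns no power here, so only nonnegativity of the right
      side remains to be shown.\<close>
    then have "phi j = 0" by (subst phi) simp
    moreover have "psd (mac_cov v phi j)"
      by (rule psd_mac_cov) (use prefix j in blast)
    ultimately show ?thesis
      using psd_trace_mult_nonneg psdQ[OF j]
      unfolding trace_mac_cov_mult[symmetric] by simp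
  next
    case False
    moreover have "0 \<le> mmse_gain v phi j"
      by (rule mmse_gain_nonneg) (use prefix j in blast)
    ultimately have "0 < mmse_gain v phi j"
      by simp
    moreover have "mmse_gain v phi j * (phi j * a j) = quad_form (Q j) (v j)"
      using ratio[OF j] a[OF j] by (simp add: field_simps)
    moreover have "quad_form (Q j) (v j) \<le> mmse_gain v phi j * Re (trace (mac_cov v phi j ** Q j))"
      by (rule quad_form_le_mmse_gain_trace) (use prefix psdQ j in blast)+
    ultimately show ?thesis
      unfolding trace_mac_cov_mult[symmetric] by (metis mult_le_cancel_left_pos)
  qed
  then have "(\<Sum>j=1..N. phi j * a j)
      \<le> (\<Sum>j=1..N. Re (trace (Q j)) + (\<Sum>k\<in>{1..<j}. phi k * quad_form (Q j) (v k)))"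
    by (rule sum_mono)
  then have "(\<Sum>j=1..N. phi j) \<le> (\<Sum>j=1..N. Re (trace (Q j)))"
    unfolding sum.distrib a_def power_balance by simp
  then show thesis
    by (intro that[of phi]) (use nonneg ratio[unfolded a_def] in blast)+
qed

subsection \<open>Rescaling by positive multipliers\<close>

definition channel_vec :: "complex ^ 'n ^ 1 \<Rightarrow> complex ^ 'n" where
  "channel_vec h = (\<chi> l. cnj (h $ 1 $ l))"

lemma channel_form:
  "(h ** A ** conj_transpose h) $ 1 $ 1 = cdot (channel_vec h) (A *v channel_vec h)"
  unfolding matrix_mul_assoc[symmetric]
  by (simp add: matrix_matrix_mult_def matrix_vector_mult_def cdot_def channel_vec_def conj_transpose_def)

lemma channel_outer: "conj_transpose h ** h = outer (channel_vec h)"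
  by (simp add: vec_eq_iff matrix_matrix_mult_def outer_def channel_vec_def conj_transpose_def)

lemma channel_vec_mult:
  assumes "conj_transpose T = T"
  shows "channel_vec (h ** T) = T *v channel_vec h"
proof -
  have "cnj (T $ k $ l) = T $ l $ k" for k l
    by (subst assms[symmetric]) (simp add: conj_transpose_def)
  then show ?thesis
    by (simp add: vec_eq_iff matrix_matrix_mult_def matrix_vector_mult_def channel_vec_def mult.commute)
qed

text \<open>Hermitian covariances make signal and noise real numbers, so \<open>Re\<close> passes
  through the quotient.\<close>

lemma bc_snr:
  assumes psd: "\<And>k. k \<in> {1..N} \<Longrightarrow> psd (Q i k)" and j: "j \<in> {1..N}"
  shows "Re (1 + (h i j ** Q i j ** conj_transpose (h i j)) $ 1 $ 1 * inverse (bc_noise N h Q i j)) =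
    1 + quad_form (Q i j) (channel_vec (h i j)) /
      bc_interference N (\<lambda>j. channel_vec (h i j)) (Q i) j"
proof -
  let ?v = "channel_vec (h i j)"
  have herm: "conj_transpose (Q i k) = Q i k" if "k \<in> {1..N}" for k
    using psd[OF that] by (simp add: psd_iff)
  have "conj_transpose (\<Sum>k=j+1..N. Q i k) = (\<Sum>k=j+1..N. Q i k)"
    unfolding conj_transpose_sum by (rule sum.cong) (auto intro!: herm)
  then have noise: "bc_noise N h Q i j = of_real (bc_interference N (\<lambda>j. channel_vec (h i j)) (Q i) j)"
    unfolding bc_noise_def channel_form bc_interference_def quad_form_sum[symmetric]
    by (subst hermitian_cdot) simp_all
  have "Re (1 + of_real a * inverse (of_real b)) = 1 + a / b" for a b
    by (simp only: plus_complex.sel one_complex.sel of_real_inverse[symmetric] of_real_mult[symmetric]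
        Re_complex_of_real divide_inverse)
  then show ?thesis
    unfolding channel_form noise hermitian_cdot[OF herm[OF j]] .
qed

text \<open>The matrix added to the identity has rank one, so the determinant lemma applies.\<close>

lemma mac_snr:
  fixes h :: "nat \<Rightarrow> nat \<Rightarrow> complex ^ 'l ^ 1"
  shows "Re (det (mat 1 + mac_gain h phi i j ** matrix_inv (mac_noise h phi i j))) =
    1 + phi i j * mmse_gain (\<lambda>j. channel_vec (h i j)) (phi i) j"
proof -
  define v where "v = channel_vec (h i j)"
  define B where "B = matrix_inv (mac_noise h phi i j)"
  \<comment> \<open>The entries of the row v^H B, the right factor of the rank-one matrix.\<close>
  define y where "y = (\<chi> j. \<Sum>k\<in>UNIV. cnj (v $ k) * B $ k $ j)"
  have "mac_noise h phi i j = mac_cov (\<lambda>j. channel_vec (h i j)) (phi i) j"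
    by (simp add: mac_noise_def mac_cov_def mac_gain_def channel_outer)
  then have gain: "mmse_gain (\<lambda>j. channel_vec (h i j)) (phi i) j = Re (cdot v (B *v v))"
    by (simp add: mmse_gain_def quad_form_def B_def v_def)
  have "(\<Sum>l\<in>UNIV. v $ l * y $ l) = (\<Sum>l\<in>UNIV. \<Sum>k\<in>UNIV. v $ l * (cnj (v $ k) * B $ k $ l))"
    by (simp add: y_def sum_distrib_left)
  also have "\<dots> = (\<Sum>k\<in>UNIV. \<Sum>l\<in>UNIV. v $ l * (cnj (v $ k) * B $ k $ l))"
    by (rule sum.swap)
  also have "\<dots> = cdot v (B *v v)"
    by (simp add: cdot_def matrix_vector_mult_def sum_distrib_left mult_ac)
  finally have vy: "(\<Sum>l\<in>UNIV. v $ l * y $ l) = cdot v (B *v v)" .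
  have "mac_gain h phi i j ** B = (\<chi> k l. (phi i j *\<^sub>R v) $ k * y $ l)"
    unfolding mac_gain_def channel_outer scalar_matrix_assoc[symmetric] v_def[symmetric]
    by (simp add: vec_eq_iff outer_def matrix_matrix_mult_def y_def sum_distrib_left scaleR_sum_right
        mult_ac)
  then have "det (mat 1 + mac_gain h phi i j ** B) = 1 + (\<Sum>l\<in>UNIV. (phi i j *\<^sub>R v) $ l * y $ l)"
    by (simp only: det_identity_plus_rank_one)
  also have "(\<Sum>l\<in>UNIV. (phi i j *\<^sub>R v) $ l * y $ l) = phi i j *\<^sub>R cdot v (B *v v)"
    by (simp add: vy[symmetric] scaleR_sum_right)
  finally show ?thesis
    by (simp add: gain flip: B_def)
qed

section \<open>Congruence with the square root of the multiplier matrix\<close>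

lemma quad_form_congruence:
  "conj_transpose T = T \<Longrightarrow> quad_form (T ** A ** T) x = quad_form A (T *v x)"
  unfolding quad_form_def matrix_mul_assoc[symmetric] matrix_vector_mul_assoc[symmetric]
  by (subst cdot_adjoint) simp

lemma psd_congruence:
  assumes "conj_transpose T = T" and "psd A"
  shows "psd (T ** A ** T)"
  using assms by (simp add: psd_iff conj_transpose_mult quad_form_congruence matrix_mul_assoc)

lemma diag_mat_mult: "diag_mat u ** diag_mat v = diag_mat (\<chi> l. u $ l * v $ l)"
  by (simp add: vec_eq_iff diag_mat_def matrix_matrix_mult_def mult_delta_left)

context
  fixes lam :: "real ^ 'l"
  assumes lam_pos: "\<And>l. 0 < lam $ l"
begin

lemma diag_inv_sqrt_eq: "diag_inv_sqrt lam = diag_mat (\<chi> l. 1 / sqrt (lam $ l))"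
  and diag_sqrt_inverse_right: "diag_sqrt lam ** diag_inv_sqrt lam = mat 1"
  and diag_sqrt_inverse_left: "diag_inv_sqrt lam ** diag_sqrt lam = mat 1"
proof -
  let ?T = "diag_mat (\<chi> l. 1 / sqrt (lam $ l))"
  have nz: "sqrt (lam $ l) \<noteq> 0" for l
    using lam_pos[of l] by simp
  have 1: "diag_sqrt lam ** ?T = mat 1" and 2: "?T ** diag_sqrt lam = mat 1"
    unfolding diag_sqrt_def diag_mat_mult using nz by (auto simp: vec_eq_iff diag_mat_def mat_def)
  show 3: "diag_inv_sqrt lam = ?T"
    unfolding diag_inv_sqrt_def by (rule matrix_inv_eqI[OF 1 2])
  show "diag_sqrt lam ** diag_inv_sqrt lam = mat 1"
    unfolding 3 by (rule 1)
  show "diag_inv_sqrt lam ** diag_sqrt lam = mat 1"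
    unfolding 3 by (rule 2)
qed

lemma hermitian_diag_inv_sqrt: "conj_transpose (diag_inv_sqrt lam) = diag_inv_sqrt lam"
  by (simp only: diag_inv_sqrt_eq conj_transpose_diag_mat)

lemma hermitian_diag_sqrt: "conj_transpose (diag_sqrt lam) = diag_sqrt lam"
  by (simp only: diag_sqrt_def conj_transpose_diag_mat)

lemma diag_sqrt_square: "diag_sqrt lam ** diag_sqrt lam = diag_mat lam"
proof -
  have "(\<chi> l. sqrt (lam $ l) * sqrt (lam $ l)) = lam"
    by (simp add: vec_eq_iff less_imp_le[OF lam_pos])
  then show ?thesis
    by (simp add: diag_sqrt_def diag_mat_mult)
qed

text \<open>By cyclicity of the trace, the congruence turns power weighted by the multipliers into
  plain power.\<close>

lemma trace_diag_sqrt_congruence: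
  "trace (diag_sqrt lam ** Q ** diag_sqrt lam) = trace (diag_mat lam ** Q)"
  by (subst trace_mul_sym) (simp only: matrix_mul_assoc diag_sqrt_square)

lemma diag_inv_sqrt_congruence_inverse:
  "diag_sqrt lam ** (diag_inv_sqrt lam ** Q ** diag_inv_sqrt lam) ** diag_sqrt lam = Q"
proof -
  have "diag_sqrt lam ** (diag_inv_sqrt lam ** Q ** diag_inv_sqrt lam) ** diag_sqrt lam =
      (diag_sqrt lam ** diag_inv_sqrt lam) ** Q ** (diag_inv_sqrt lam ** diag_sqrt lam)"
    by (simp only: matrix_mul_assoc)
  then show ?thesis
    by (simp only: diag_sqrt_inverse_left diag_sqrt_inverse_right matrix_mul_lid matrix_mul_rid)
qed

lemma scaled_channel_vec:
  "diag_sqrt lam *v channel_vec (scaled_channel h lam i j) = channel_vec (h i j)"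
proof -
  have "diag_sqrt lam *v channel_vec (scaled_channel h lam i j) =
      (diag_sqrt lam ** diag_inv_sqrt lam) *v channel_vec (h i j)"
    unfolding scaled_channel_def channel_vec_mult[OF hermitian_diag_inv_sqrt] matrix_vector_mul_assoc ..
  then show ?thesis
    by (simp only: diag_sqrt_inverse_right matrix_vector_mul_lid)
qed

text \<open>The precoder in the channel cancels the square roots around the covariance, so rates
  survive the rescaling.\<close>

lemma quad_form_scaled_channel:
  "quad_form (diag_sqrt lam ** Q ** diag_sqrt lam) (channel_vec (scaled_channel h lam i j)) =
    quad_form Q (channel_vec (h i j))"
  by (simp only: quad_form_congruence[OF hermitian_diag_sqrt] scaled_channel_vec)

lemma mac_objective_eq:
  "mac_objective Nc N h w P lam phi =
    (\<Sum>i=1..Nc. (\<Sum>j=1..N. w j * log 2 (1 + phi i j *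
        mmse_gain (\<lambda>j. channel_vec (scaled_channel h lam i j)) (phi i) j)) - (\<Sum>j=1..N. phi i j))
      + Re (trace (diag_mat lam ** diag_mat P))"
  unfolding mac_objective_def Let_def mac_snr trace_diag_sqrt_congruence ..

text \<open>Reduces the broadcast objective to unit multipliers, the setting of the one-tone
  duality. The equation for R holds at all indices, so it rewrites inside sums without range
  conditions.\<close>

lemma bc_objective_eq:
  assumes psd: "\<forall>i\<in>{1..Nc}. \<forall>j\<in>{1..N}. psd (Q i j)"
    and R: "\<forall>i j. R i j = diag_sqrt lam ** Q i j ** diag_sqrt lam"
  shows "bc_objective Nc N h w P lam Q =
    (\<Sum>i=1..Nc. (\<Sum>j=1..N. w j * log 2 (1 +
        quad_form (R i j) (channel_vec (scaled_channel h lam i j)) /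
        bc_interference N (\<lambda>j. channel_vec (scaled_channel h lam i j)) (R i) j))
        - (\<Sum>j=1..N. Re (trace (R i j))))
      + Re (trace (diag_mat lam ** diag_mat P))"
proof -
  have "Re (1 + (h i j ** Q i j ** conj_transpose (h i j)) $ 1 $ 1 * inverse (bc_noise N h Q i j)) =
      1 + quad_form (R i j) (channel_vec (scaled_channel h lam i j)) /
        bc_interference N (\<lambda>j. channel_vec (scaled_channel h lam i j)) (R i) j"
    if "i \<in> {1..Nc}" "j \<in> {1..N}" for i j
  proof -
    have "bc_interference N (\<lambda>j. channel_vec (scaled_channel h lam i j)) (R i) j =
        bc_interference N (\<lambda>j. channel_vec (h i j)) (Q i) j"
      by (simp only: bc_interference_def R[rule_format] quad_form_scaled_channel)
    moreover have "quad_form (R i j) (channel_vec (scaled_channel h lam i j)) =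
        quad_form (Q i j) (channel_vec (h i j))"
      by (simp only: R[rule_format] quad_form_scaled_channel)
    ultimately show ?thesis
      using that psd by (simp only:) (rule bc_snr, blast+)
  qed
  moreover have "trace (R i j) = trace (diag_mat lam ** Q i j)" for i j
    by (simp only: R[rule_format] trace_diag_sqrt_congruence)
  ultimately show ?thesis
    unfolding bc_objective_def by (simp only: cong: sum.cong)
qed

text \<open>Tones do not interact, so \<open>ex_bc_covariances\<close> is applied to each one
  separately.\<close>

lemma F_MAC_regular_le_F_BC: "F_MAC_regular Nc N h w P lam \<le> F_BC Nc N h w P lam"
  unfolding F_MAC_regular_def
proof (rule SUP_least)
  fix phi :: "nat \<Rightarrow> nat \<Rightarrow> real"
  assume "phi \<in> {phi. \<forall>i\<in>{1..Nc}. \<forall>j\<in>{1..N}. 0 \<le> phi i j}"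
  then have phi: "0 \<le> phi i j" if "i \<in> {1..Nc}" "j \<in> {1..N}" for i j
    using that by blast
  let ?v = "\<lambda>i j. channel_vec (scaled_channel h lam i j)"
  have "\<forall>i\<in>{1..Nc}. \<exists>Q. (\<forall>j\<in>{1..N}. psd (Q j) \<and>
      quad_form (Q j) (?v i j) / bc_interference N (?v i) Q j = phi i j * mmse_gain (?v i) (phi i) j) \<and>
      (\<Sum>j=1..N. Re (trace (Q j))) \<le> (\<Sum>j=1..N. phi i j)"
  proof
    fix i assume "i \<in> {1..Nc}"
    then have "\<And>j. j \<in> {1..N} \<Longrightarrow> 0 \<le> phi i j"
      using phi by blast
    then show "\<exists>Q. (\<forall>j\<in>{1..N}. psd (Q j) \<and>
      quad_form (Q j) (?v i j) / bc_interference N (?v i) Q j = phi i j * mmse_gain (?v i) (phi i) j) \<and>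
      (\<Sum>j=1..N. Re (trace (Q j))) \<le> (\<Sum>j=1..N. phi i j)"
      by (rule ex_bc_covariances[of N "phi i" "?v i"]) blast+
  qed
  then obtain R where R: "\<And>i j. i \<in> {1..Nc} \<Longrightarrow> j \<in> {1..N} \<Longrightarrow> psd (R i j)"
    and ratio: "\<And>i j. i \<in> {1..Nc} \<Longrightarrow> j \<in> {1..N} \<Longrightarrow>
      quad_form (R i j) (?v i j) / bc_interference N (?v i) (R i) j = phi i j * mmse_gain (?v i) (phi i) j"
    and power: "\<And>i. i \<in> {1..Nc} \<Longrightarrow> (\<Sum>j=1..N. Re (trace (R i j))) \<le> (\<Sum>j=1..N. phi i j)"
    unfolding bchoice_iff by blast
  \<comment> \<open>Undoing the congruence gives covariances for the original channel whose rescaled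
    versions are R.\<close>
  define Q where "Q i j = diag_inv_sqrt lam ** R i j ** diag_inv_sqrt lam" for i j
  have Q: "\<forall>i\<in>{1..Nc}. \<forall>j\<in>{1..N}. psd (Q i j)"
    unfolding Q_def using hermitian_diag_inv_sqrt R by (blast intro: psd_congruence)
  have R_eq: "\<forall>i j. R i j = diag_sqrt lam ** Q i j ** diag_sqrt lam"
    by (simp only: Q_def diag_inv_sqrt_congruence_inverse simp_thms)
  \<comment> \<open>The rate terms agree exactly by \<open>ratio\<close>; the inequality comes from
    the subtracted powers alone.\<close>
  have "mac_objective Nc N h w P lam phi \<le> bc_objective Nc N h w P lam Q"
    unfolding mac_objective_eq bc_objective_eq[OF Q R_eq]
    by (intro add_right_mono sum_mono[of "{1..Nc}"] diff_mono power eq_refl[OF sum.cong]) (simp_all add: ratio)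
  then show "ereal (mac_objective Nc N h w P lam phi) \<le> F_BC Nc N h w P lam"
    unfolding F_BC_def using Q by (intro SUP_upper2[where i = Q]) auto
qed

lemma F_BC_le_F_MAC_regular: "F_BC Nc N h w P lam \<le> F_MAC_regular Nc N h w P lam"
  unfolding F_BC_def
proof (rule SUP_least)
  fix Q :: "nat \<Rightarrow> nat \<Rightarrow> complex ^ 'l ^ 'l"
  assume "Q \<in> {Q. \<forall>i\<in>{1..Nc}. \<forall>j\<in>{1..N}. psd (Q i j)}"
  then have Q: "\<forall>i\<in>{1..Nc}. \<forall>j\<in>{1..N}. psd (Q i j)"
    by blast
  let ?v = "\<lambda>i j. channel_vec (scaled_channel h lam i j)"
  define R where "R i j = diag_sqrt lam ** Q i j ** diag_sqrt lam" for i j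
  have R: "psd (R i j)" if "i \<in> {1..Nc}" "j \<in> {1..N}" for i j
    unfolding R_def using hermitian_diag_sqrt Q that by (blast intro: psd_congruence)
  have "\<forall>i\<in>{1..Nc}. \<exists>phi. (\<forall>j\<in>{1..N}. 0 \<le> phi j \<and>
      quad_form (R i j) (?v i j) / bc_interference N (?v i) (R i) j = phi j * mmse_gain (?v i) phi j) \<and>
      (\<Sum>j=1..N. phi j) \<le> (\<Sum>j=1..N. Re (trace (R i j)))"
  proof
    fix i assume "i \<in> {1..Nc}"
    then have "\<And>j. j \<in> {1..N} \<Longrightarrow> psd (R i j)"
      using R by blast
    then show "\<exists>phi. (\<forall>j\<in>{1..N}. 0 \<le> phi j \<and>
      quad_form (R i j) (?v i j) / bc_interference N (?v i) (R i) j = phi j * mmse_gain (?v i) phi j) \<and>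
      (\<Sum>j=1..N. phi j) \<le> (\<Sum>j=1..N. Re (trace (R i j)))"
      by (rule ex_mac_powers[of N "R i" "?v i"]) blast+
  qed
  then obtain phi where phi: "\<And>i j. i \<in> {1..Nc} \<Longrightarrow> j \<in> {1..N} \<Longrightarrow> 0 \<le> phi i j"
    and ratio: "\<And>i j. i \<in> {1..Nc} \<Longrightarrow> j \<in> {1..N} \<Longrightarrow>
      quad_form (R i j) (?v i j) / bc_interference N (?v i) (R i) j = phi i j * mmse_gain (?v i) (phi i) j"
    and power: "\<And>i. i \<in> {1..Nc} \<Longrightarrow> (\<Sum>j=1..N. phi i j) \<le> (\<Sum>j=1..N. Re (trace (R i j)))"
    unfolding bchoice_iff by blast
  have R_eq: "\<forall>i j. R i j = diag_sqrt lam ** Q i j ** diag_sqrt lam"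
    by (simp only: R_def simp_thms)
  have "bc_objective Nc N h w P lam Q \<le> mac_objective Nc N h w P lam phi"
    unfolding mac_objective_eq bc_objective_eq[OF Q R_eq]
    by (intro add_right_mono sum_mono[of "{1..Nc}"] diff_mono power eq_refl[OF sum.cong]) (simp_all add: ratio)
  then show "ereal (bc_objective Nc N h w P lam Q) \<le> F_MAC_regular Nc N h w P lam"
    unfolding F_MAC_regular_def using phi by (intro SUP_upper2[where i = phi]) auto
qed

lemma F_BC_eq_F_MAC_regular: "F_BC Nc N h w P lam = F_MAC_regular Nc N h w P lam"
  using F_BC_le_F_MAC_regular F_MAC_regular_le_F_BC by (rule antisym)

end

subsection \<open>Vanishing multipliers\<close>

lemma trace_psd_nonneg: "psd Q \<Longrightarrow> 0 \<le> Re (trace Q)"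
  using psd_trace_mult_nonneg[of "mat 1" Q]
  by (simp add: psd_iff conj_transpose_mat_1 quad_form_mat_1)

definition total_power :: "nat \<Rightarrow> nat \<Rightarrow> (nat \<Rightarrow> nat \<Rightarrow> complex ^ 'l ^ 'l) \<Rightarrow> real" where
  "total_power Nc N Q = (\<Sum>i=1..Nc. \<Sum>j=1..N. Re (trace (Q i j)))"

text \<open>The objective is affine in the multipliers, which enter through the traces only. Both
  halves of \<open>F_BC_tendsto\<close> rest on this.\<close>

lemma bc_objective_shift:
  "bc_objective Nc N h w P (lam + vec e) Q =
    bc_objective Nc N h w P lam Q - e * total_power Nc N Q + e * Re (trace (diag_mat P))"
proof -
  have "diag_mat (lam + vec e) = diag_mat lam + e *\<^sub>R mat 1"
    by (simp add: vec_eq_iff diag_mat_def mat_def) (simp add: scaleR_conv_of_real)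
  then have shift: "Re (trace (diag_mat (lam + vec e) ** A)) = Re (trace (diag_mat lam ** A)) + e * Re (trace A)" for A
    by (simp add: matrix_add_mult_distrib trace_add scalar_matrix_assoc[symmetric] trace_scaleR)
  show ?thesis
    unfolding bc_objective_def shift total_power_def
    by (simp add: sum.distrib sum_distrib_left sum_subtractf algebra_simps)
qed

text \<open>
  Right continuity along the diagonal: F_BC is a supremum of functions that are affine in the
  multipliers, hence lower semicontinuous, and up to the term linear in P it is antitone.
\<close>

lemma F_BC_tendsto:
  fixes P lam :: "real ^ 'l"
  shows "((\<lambda>e. F_BC Nc N h w P (lam + vec e)) \<longlongrightarrow> F_BC Nc N h w P lam) (at_right 0)"
proof (rule order_tendstoI)
  let ?A = "{Q. \<forall>i\<in>{1..Nc}. \<forall>j\<in>{1..N}. psd (Q i j)}"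
  fix a assume "a < F_BC Nc N h w P lam"
  then obtain Q where Q: "Q \<in> ?A" "a < ereal (bc_objective Nc N h w P lam Q)"
    unfolding F_BC_def less_SUP_iff by blast
  \<comment> \<open>A single \<open>Q\<close> exceeding a at \<open>lam\<close> suffices, since its
    objective is continuous in e. The factors 0 keep the limit in the shape that
    \<open>tendsto_intros\<close> produces.\<close>
  have "((\<lambda>e. ereal (bc_objective Nc N h w P (lam + vec e) Q)) \<longlongrightarrow>
      ereal (bc_objective Nc N h w P lam Q - 0 * total_power Nc N Q + 0 * Re (trace (diag_mat P)))) (at_right 0)"
    unfolding bc_objective_shift by (intro tendsto_intros)
  then have "\<forall>\<^sub>F e in at_right 0. a < ereal (bc_objective Nc N h w P (lam + vec e) Q)"
    using Q(2) by (intro order_tendstoD) auto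
  then show "\<forall>\<^sub>F e in at_right 0. a < F_BC Nc N h w P (lam + vec e)"
    by eventually_elim (use Q(1) in \<open>auto simp: F_BC_def less_SUP_iff\<close>)
next
  fix a assume a: "F_BC Nc N h w P lam < a"
  let ?c = "Re (trace (diag_mat P))"
  \<comment> \<open>Total power is nonnegative, so the shift can raise the objective by at most the
    budget term, uniformly in Q.\<close>
  have le: "F_BC Nc N h w P (lam + vec e) \<le> F_BC Nc N h w P lam + ereal (e * ?c)" if "0 < e" for e
    unfolding F_BC_def[of _ _ _ _ _ "lam + vec e"]
  proof (rule SUP_least)
    fix Q :: "nat \<Rightarrow> nat \<Rightarrow> complex ^ 'l ^ 'l"
    assume Q: "Q \<in> {Q. \<forall>i\<in>{1..Nc}. \<forall>j\<in>{1..N}. psd (Q i j)}"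
    then have "0 \<le> total_power Nc N Q"
      unfolding total_power_def by (intro sum_nonneg trace_psd_nonneg) auto
    then have "bc_objective Nc N h w P (lam + vec e) Q \<le> bc_objective Nc N h w P lam Q + e * ?c"
      using that by (simp add: bc_objective_shift)
    then have "ereal (bc_objective Nc N h w P (lam + vec e) Q)
        \<le> ereal (bc_objective Nc N h w P lam Q) + ereal (e * ?c)"
      by simp
    also have "\<dots> \<le> F_BC Nc N h w P lam + ereal (e * ?c)"
      unfolding F_BC_def by (intro add_right_mono SUP_upper Q)
    finally show "ereal (bc_objective Nc N h w P (lam + vec e) Q) \<le> \<dots>" .
  qed
  \<comment> \<open>The second summand has a finite limit, so addition in \<open>ereal\<close> is
    continuous here.\<close>
  have "((\<lambda>e. F_BC Nc N h w P lam + ereal (e * ?c)) \<longlongrightarrow> F_BC Nc N h w P lam + ereal (0 * ?c)) (at_right 0)"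
    by (intro tendsto_add_ereal_general tendsto_intros) auto
  then have "\<forall>\<^sub>F e in at_right 0. F_BC Nc N h w P lam + ereal (e * ?c) < a"
    using a by (intro order_tendstoD) (auto simp: zero_ereal_def[symmetric])
  moreover have "\<forall>\<^sub>F e in at_right (0::real). 0 < e"
    by (rule eventually_at_right_less)
  ultimately show "\<forall>\<^sub>F e in at_right 0. F_BC Nc N h w P (lam + vec e) < a"
    by eventually_elim (meson le le_less_trans)
qed

theorem mainTheorem2:
  fixes N Nc :: nat
    and h :: "nat \<Rightarrow> nat \<Rightarrow> complex ^ 'l ^ 1"
    and w :: "nat \<Rightarrow> real"
    and P lam :: "real ^ 'l"
  assumes "N \<le> CARD('l)"
    and "\<forall>j\<in>{1..N}. \<forall>k\<in>{1..N}. j < k \<longrightarrow> w k < w j"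
    and "\<forall>l. 0 \<le> lam $ l"
  shows "F_BC Nc N h w P lam = F_MAC Nc N h w P lam"
proof (cases "\<forall>l. 0 < lam $ l")
  case True
  then show ?thesis
    unfolding F_MAC_def if_P[OF True] by (intro F_BC_eq_F_MAC_regular) blast
next
  case False
  \<comment> \<open>For e > 0 all shifted multipliers are positive, so the regular case applies to
    them.\<close>
  have "F_BC Nc N h w P (lam + vec e) = F_MAC_regular Nc N h w P (lam + vec e)" if "0 < e" for e
    using assms(3) that by (intro F_BC_eq_F_MAC_regular) (simp add: add_nonneg_pos)
  then have "\<forall>\<^sub>F e in at_right 0. F_BC Nc N h w P (lam + vec e) = F_MAC_regular Nc N h w P (lam + vec e)"
    by (intro eventually_at_right_less[THEN eventually_mono])
  then have "((\<lambda>e. F_MAC_regular Nc N h w P (lam + vec e)) \<longlongrightarrow> F_BC Nc N h w P lam) (at_right 0)"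
    using F_BC_tendsto by (rule Lim_transform_eventually[rotated])
  \<comment> \<open>\<open>Lim\<close> returns the limit because \<open>at_right 0\<close> is a
    nontrivial filter and limits in \<open>ereal\<close> are unique.\<close>
  then have "Lim (at_right 0) (\<lambda>e. F_MAC_regular Nc N h w P (lam + vec e)) = F_BC Nc N h w P lam"
    by (intro tendsto_Lim) simp_all
  then show ?thesis
    unfolding F_MAC_def if_not_P[OF False] by (rule sym)
qed

end
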